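(* Let $\mu,\kappa$ be integers with $2\leq\kappa\leq\mu-2$, and consider the gradient field $W_{\mu,\kappa}$ on $X_{\mu,\kappa}=\operatorname{DConf}(\Delta^{\mu-1,\mu-\kappa-1},2)$. Any cell $(A,B)$ of $X_{\mu,\kappa}$, with $B=\{b_1<\cdots<b_s\}$, such that $s>1$ and $\langle b_s+1,\mu\rangle\subseteq A$ is collapsible. In fact, $$(A,B\setminus\{b_s\})\nearrow(A,B)\qquad( * )$$ is a directed edge in $W_{\mu,\kappa}$. Furthermore, the directed edges $( * )$, for $(A,B)$ ranging over all cells of $X_{\mu,\kappa}$ with $B=\{b_1<\cdots<b_s\}$, $s>1$ and $\langle b_s+1,\mu\rangle\subseteq A$, account for all directed edges in $W_{\mu,\kappa}$ that arise by insertion of a vertex in the second coordinate of a cell of $X_{\mu,\kappa}$ (i.e. edges of the form $(A',B')\nearrow(A',B'\cup\{u\})$).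
   Context: For integers $p,q$, $\langle p,q\rangle=\{p,p+1,\ldots,q\}$, empty if $p>q$. $\Delta^{\mu-1,\mu-\kappa-1}$ is the $(\mu-\kappa-1)$-skeleton of the simplex with vertex set $\{1,2,\ldots,\mu\}$. $X=X_{\mu,\kappa}=\operatorname{DConf}(\Delta^{\mu-1,\mu-\kappa-1},2)$ is the subcomplex of the product cell complex of two copies of this skeleton consisting of products of two simplices with disjoint vertex sets. Its cells are the ordered pairs $(A,B)$ of disjoint nonempty subsets of $\{1,\ldots,\mu\}$, each of cardinality at most $\mu-\kappa$; the cell $(A,B)$ has dimension $|A|+|B|-2$, and faces are given by coordinatewise inclusion. For a cell $\alpha=(A,B)$ and $u\notin A\cup B$, put $\alpha+_1u=(A\cup\{u\},B)$ and $\alpha+_2u=(A,B\cup\{u\})$, whenever the result is a cell of $X$. Order on cells: simplices (vertex sets written as increasing lists) are ordered by dimension first and lexicographically within the same dimension; cells $(A,B)$ are ordered lexicographically over the two coordinates. Construction of $W=W_{\mu,\kappa}$: initialize $W:=\varnothing$ and, for each $p$, let $A^p$ be the set of all $p$-dimensional cells of $X$. For $p=\dim X-1,\ldots,1,0$ (in that order), provided $A^p$ and $A^{p+1}$ are currently nonempty, do: for $r=2,1$ (in that order); for $u=\mu,\mu-1,\ldots,1$ (in that order); for $\alpha$ running through the current $A^p$ in increasing order: if $\alpha+_ru$ is defined and currently $(\alpha,\alpha+_ru)\in A^p\times A^{p+1}$, add the directed edge $\alpha\nearrow\alpha+_ru$ to $W$, and remove $\alpha$ from $A^p$ and $\alpha+_ru$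 from $A^{p+1}$. For a directed edge $\alpha\nearrow\beta$ in the final $W$, $\beta$ is called collapsible and $\alpha$ redundant; cells in no edge of $W$ are critical. *)

theory Defs
  imports Main "HOL-Library.List_Lenlexorder" "HOL-Library.Product_Lexorder"
begin

type_synonym cell = "nat set \<times> nat set"

text \<open>A simplex is identified with its nonempty set of vertices, and has dimension
  \<open>card A - 1\<close>.\<close>

definition simplex_skeleton :: "nat \<Rightarrow> nat \<Rightarrow> nat set set" where
  "simplex_skeleton n d = {A. A \<noteq> {} \<and> A \<subseteq> {1..n} \<and> card A - 1 \<le> d}"

definition dconf2 :: "nat set set \<Rightarrow> cell set" where
  "dconf2 K = {(A, B). A \<in> K \<and> B \<in> K \<and> A \<inter> B = {}}"

definition X_cells :: "nat \<Rightarrow> nat \<Rightarrow> cell set" where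
  "X_cells \<mu> \<kappa> = dconf2 (simplex_skeleton \<mu> (\<mu> - \<kappa> - 1))"

definition cell_dim :: "cell \<Rightarrow> nat" where
  "cell_dim \<alpha> = card (fst \<alpha>) + card (snd \<alpha>) - 2"

definition complex_dim :: "cell set \<Rightarrow> nat" where
  "complex_dim X = Max (cell_dim ` X)"

text \<open>Keys are compared by the imported orders: lists by length first and then
  lexicographically, pairs lexicographically.\<close>

definition cell_key :: "cell \<Rightarrow> nat list \<times> nat list" where
  "cell_key \<alpha> = (sorted_list_of_set (fst \<alpha>), sorted_list_of_set (snd \<alpha>))"

definition increasing_cells :: "cell set \<Rightarrow> cell list" where
  "increasing_cells S = sorted_key_list_of_set cell_key S"

definition add_vertex :: "nat \<Rightarrow> cell \<Rightarrow> nat \<Rightarrow> cell" where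
  "add_vertex r \<alpha> u =
     (if r = 1 then (insert u (fst \<alpha>), snd \<alpha>) else (fst \<alpha>, insert u (snd \<alpha>)))"

definition add_vertex_defined :: "cell set \<Rightarrow> nat \<Rightarrow> cell \<Rightarrow> nat \<Rightarrow> bool" where
  "add_vertex_defined X r \<alpha> u \<longleftrightarrow>
     u \<notin> fst \<alpha> \<union> snd \<alpha> \<and> add_vertex r \<alpha> u \<in> X"

text \<open>The state of the construction consists of the directed edges found so far, an edge
  \<open>\<alpha> \<nearrow> \<beta>\<close> being the pair \<open>(\<alpha>, \<beta>)\<close>, and the family \<open>F\<close> of the current sets
  \<open>F p = A\<^sup>p\<close> of available cells.\<close>

type_synonym state = "(cell \<times> cell) set \<times> (nat \<Rightarrow> cell set)"

definition cell_step :: "cell set \<Rightarrow> nat \<Rightarrow> nat \<Rightarrow> nat \<Rightarrow> cell \<Rightarrow> state \<Rightarrow> state" where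
  "cell_step X p r u \<alpha> = (\<lambda>(W, F).
     if add_vertex_defined X r \<alpha> u \<and> \<alpha> \<in> F p \<and> add_vertex r \<alpha> u \<in> F (p + 1)
     then (insert (\<alpha>, add_vertex r \<alpha> u) W,
           F(p := F p - {\<alpha>}, p + 1 := F (p + 1) - {add_vertex r \<alpha> u}))
     else (W, F))"

text \<open>Within one pass over \<open>A\<^sup>p\<close> the only cell that a step removes from \<open>A\<^sup>p\<close> is the one
  being visited, so the list of cells to visit may be fixed at the beginning of the pass.\<close>

definition vertex_step :: "cell set \<Rightarrow> nat \<Rightarrow> nat \<Rightarrow> nat \<Rightarrow> state \<Rightarrow> state" where
  "vertex_step X p r u s = fold (cell_step X p r u) (increasing_cells (snd s p)) s"

definition coordinate_step :: "nat \<Rightarrow> cell set \<Rightarrow> nat \<Rightarrow> nat \<Rightarrow> state \<Rightarrow> state" where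
  "coordinate_step \<mu> X p r = fold (vertex_step X p r) (rev [1..<\<mu> + 1])"

definition dimension_step :: "nat \<Rightarrow> cell set \<Rightarrow> nat \<Rightarrow> state \<Rightarrow> state" where
  "dimension_step \<mu> X p s =
     (if snd s p \<noteq> {} \<and> snd s (p + 1) \<noteq> {}
      then fold (coordinate_step \<mu> X p) [2, 1] s
      else s)"

definition gradient_field :: "nat \<Rightarrow> nat \<Rightarrow> (cell \<times> cell) set" where
  "gradient_field \<mu> \<kappa> =
     (let X = X_cells \<mu> \<kappa>
      in fst (fold (dimension_step \<mu> X) (rev [0..<complex_dim X])
                   ({}, \<lambda>p. {\<alpha> \<in> X. cell_dim \<alpha> = p})))"

definition collapsible :: "(cell \<times> cell) set \<Rightarrow> cell \<Rightarrow> bool" where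
  "collapsible W \<beta> \<longleftrightarrow> (\<exists>\<alpha>. (\<alpha>, \<beta>) \<in> W)"

end

theory Submission
  imports Defs
begin

text \<open>Call \<open>(A, B)\<close> with \<open>|B| > 1\<close> a tail cell at \<open>u = max B\<close> if \<open>\<langle>u + 1, \<mu>\<rangle> \<subseteq> A\<close>. In dimension \<open>p\<close>
  with \<open>r = 2\<close>, the pass for \<open>u\<close> creates exactly the edges into the tail cells at \<open>u\<close>: let
  \<open>(A, B) \<nearrow> (A, B \<union> {u})\<close> be a candidate and \<open>v\<close> the largest vertex outside \<open>A\<close>, so \<open>v \<ge> u\<close>. If
  \<open>v > u\<close>, then either \<open>v \<in> B\<close>, and \<open>(A, B \<union> {u})\<close> is a tail cell at \<open>v\<close>, or \<open>v \<notin> B\<close>, and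
  \<open>(A, B \<union> {v})\<close> is a tail cell at \<open>v\<close>; in both cases the pass for \<open>v\<close> has used up one end of the
  candidate. Conversely, tail cells are still available when their pass comes: they are not
  sources of edges with \<open>r = 2\<close>, nor of edges with \<open>r = 1\<close>, because enlarging \<open>A\<close> leads to another
  tail cell, which has already been removed during \<open>r = 2\<close>.\<close>

lemma X_cells_iff:
  "(A, B) \<in> X_cells \<mu> \<kappa> \<longleftrightarrow> A \<noteq> {} \<and> B \<noteq> {} \<and> A \<subseteq> {1..\<mu>} \<and> B \<subseteq> {1..\<mu>} \<and> A \<inter> B = {} \<and>
     card A - 1 \<le> \<mu> - \<kappa> - 1 \<and> card B - 1 \<le> \<mu> - \<kappa> - 1"
  by (auto simp: X_cells_def dconf2_def simplex_skeleton_def)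

lemma finite_X_cells: "finite (X_cells \<mu> \<kappa>)"
  by (rule finite_subset[of _ "Pow {1..\<mu>} \<times> Pow {1..\<mu>}"])
     (auto simp: X_cells_def dconf2_def simplex_skeleton_def)

lemma X_cells_finite:
  assumes "(A, B) \<in> X_cells \<mu> \<kappa>"
  shows "finite A" "finite B"
  using assms by (auto simp: X_cells_iff intro: finite_subset)

lemma inj_on_cell_key: "inj_on cell_key (X_cells \<mu> \<kappa>)"
proof (rule inj_onI, clarify)
  fix A B A' B'
  assume "(A, B) \<in> X_cells \<mu> \<kappa>" "(A', B') \<in> X_cells \<mu> \<kappa>" "cell_key (A, B) = cell_key (A', B')"
  then show "A = A' \<and> B = B'"
    unfolding cell_key_def
    by (metis X_cells_finite fst_conv snd_conv prod.inject set_sorted_list_of_set)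
qed

lemma increasing_cells:
  assumes "S \<subseteq> X_cells \<mu> \<kappa>"
  shows "set (increasing_cells S) = S" "distinct (increasing_cells S)"
proof -
  have insort: "linorder.insort_key (\<le>) cell_key = insort_key cell_key"
  proof (intro ext)
    fix x xs
    show "linorder.insort_key (\<le>) cell_key x xs = insort_key cell_key x xs"
      by (induction xs) (simp_all add: linorder.insort_key.simps[OF linorder_class.linorder_axioms])
  qed
  interpret folding_insort_key "(\<le>)" "(<)" "X_cells \<mu> \<kappa>" cell_key
    rewrites "linorder.sorted_key_list_of_set (\<le>) cell_key = sorted_key_list_of_set cell_key"
    by unfold_locales
       (simp_all add: inj_on_cell_key insort linorder_class.sorted_key_list_of_set_def
          linorder.sorted_key_list_of_set_def[OF linorder_class.linorder_axioms])
  have "finite S"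
    using assms finite_X_cells finite_subset by blast
  then show "set (increasing_cells S) = S" "distinct (increasing_cells S)"
    using assms set_sorted_key_list_of_set[of S] distinct_sorted_key_list_of_set[of S]
    by (simp_all add: increasing_cells_def distinct_map)
qed

lemma cell_dim_insert:
  assumes "(A, B) \<in> X_cells \<mu> \<kappa>" "u \<notin> B"
  shows "cell_dim (A, insert u B) = Suc (cell_dim (A, B))"
proof -
  have "card A > 0" "card B > 0"
    using assms X_cells_finite[OF assms(1)] by (auto simp: X_cells_iff card_gt_0_iff)
  then show ?thesis
    using assms X_cells_finite[OF assms(1)] by (auto simp: cell_dim_def)
qed

definition matched :: "cell set \<Rightarrow> nat \<Rightarrow> nat \<Rightarrow> nat \<Rightarrow> (nat \<Rightarrow> cell set) \<Rightarrow> cell set" where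
  "matched X p r u F =
     {\<alpha> \<in> F p. add_vertex_defined X r \<alpha> u \<and> add_vertex r \<alpha> u \<in> F (p + 1)}"

lemma add_vertex_inj:
  assumes "add_vertex_defined X r \<alpha> u" "add_vertex_defined X r \<beta> u"
    "add_vertex r \<alpha> u = add_vertex r \<beta> u"
  shows "\<alpha> = \<beta>"
  using assms
  by (cases \<alpha>; cases \<beta>) (auto simp: add_vertex_defined_def add_vertex_def split: if_splits)

lemma fold_cell_step:
  assumes "distinct xs"
  shows "fold (cell_step X p r u) xs (W, F) =
    (W \<union> (\<lambda>\<alpha>. (\<alpha>, add_vertex r \<alpha> u)) ` (matched X p r u F \<inter> set xs),
     F(p := F p - matched X p r u F \<inter> set xs,
       p + 1 := F (p + 1) - (\<lambda>\<alpha>. add_vertex r \<alpha> u) ` (matched X p r u F \<inter> set xs)))"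
  using assms
proof (induction xs arbitrary: W F)
  case Nil
  then show ?case by simp
next
  case (Cons x xs)
  show ?case
  proof (cases "x \<in> matched X p r u F")
    case True
    define F' where "F' = F(p := F p - {x}, p + 1 := F (p + 1) - {add_vertex r x u})"
    have step: "cell_step X p r u x (W, F) = (insert (x, add_vertex r x u) W, F')"
      using True by (auto simp: cell_step_def matched_def F'_def)
    have m: "matched X p r u F' = matched X p r u F - {x}"
      using True add_vertex_inj[of X r _ u x] by (auto simp: matched_def F'_def)
    define N where "N = matched X p r u F \<inter> set xs"
    have N: "matched X p r u F' \<inter> set xs = N"
      using Cons.prems m by (auto simp: N_def)
    have "matched X p r u F \<inter> set (x # xs) = insert x N"
      using True by (auto simp: N_def)
    moreover have "fold (cell_step X p r u) (x # xs) (W, F) =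
        (insert (x, add_vertex r x u) W \<union> (\<lambda>\<alpha>. (\<alpha>, add_vertex r \<alpha> u)) ` N,
         F'(p := F' p - N, p + 1 := F' (p + 1) - (\<lambda>\<alpha>. add_vertex r \<alpha> u) ` N))"
      using Cons.IH[of "insert (x, add_vertex r x u) W" F'] Cons.prems unfolding N
      by (simp add: step del: fun_upd_apply)
    ultimately show ?thesis
      by (auto simp: F'_def fun_eq_iff)
  next
    case False
    then have "cell_step X p r u x (W, F) = (W, F)"
      by (auto simp: cell_step_def matched_def)
    moreover have "matched X p r u F \<inter> set (x # xs) = matched X p r u F \<inter> set xs"
      using False by auto
    ultimately show ?thesis
      using Cons by simp
  qed
qed

lemma vertex_step_eq:
  assumes "F p \<subseteq> X_cells \<mu> \<kappa>"
  shows "vertex_step X p r u (W, F) =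
    (W \<union> (\<lambda>\<alpha>. (\<alpha>, add_vertex r \<alpha> u)) ` matched X p r u F,
     F(p := F p - matched X p r u F,
       p + 1 := F (p + 1) - (\<lambda>\<alpha>. add_vertex r \<alpha> u) ` matched X p r u F))"
proof -
  have "matched X p r u F \<inter> set (increasing_cells (F p)) = matched X p r u F"
    using increasing_cells[OF assms] by (auto simp: matched_def)
  then show ?thesis
    using fold_cell_step[OF increasing_cells(2)[OF assms], of X p r u W F]
    by (simp add: vertex_step_def)
qed

definition tail_cells :: "nat \<Rightarrow> nat \<Rightarrow> nat \<Rightarrow> cell set" where
  "tail_cells \<mu> \<kappa> u =
     {(A, B) \<in> X_cells \<mu> \<kappa>. u \<in> B \<and> B \<subseteq> {..u} \<and> B \<noteq> {u} \<and> {u<..\<mu>} \<subseteq> A}"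

lemma tail_cells_iff:
  "(A, B) \<in> tail_cells \<mu> \<kappa> u \<longleftrightarrow>
     (A, B) \<in> X_cells \<mu> \<kappa> \<and> card B > 1 \<and> Max B = u \<and> {Max B + 1..\<mu>} \<subseteq> A"
proof (cases "(A, B) \<in> X_cells \<mu> \<kappa>")
  case True
  then have "finite B" "B \<noteq> {}"
    by (simp_all add: X_cells_finite) (simp add: X_cells_iff)
  then have Max: "u \<in> B \<and> B \<subseteq> {..u} \<longleftrightarrow> Max B = u"
    using Max_eq_iff[of B u] by blast
  have card: "B \<noteq> {u} \<longleftrightarrow> card B > 1" if "u \<in> B"
  proof
    assume "B \<noteq> {u}"
    with that obtain b where "b \<in> B" "b \<noteq> u" by blast
    then show "card B > 1"
      using that card_mono[OF \<open>finite B\<close>, of "{b, u}"] by simp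
  qed auto
  have "(A, B) \<in> tail_cells \<mu> \<kappa> u \<longleftrightarrow>
      (u \<in> B \<and> B \<subseteq> {..u}) \<and> B \<noteq> {u} \<and> {u + 1..\<mu>} \<subseteq> A"
    using True by (simp add: tail_cells_def atLeastSucAtMost_greaterThanAtMost)
  also have "\<dots> \<longleftrightarrow> card B > 1 \<and> Max B = u \<and> {Max B + 1..\<mu>} \<subseteq> A"
    using Max card by metis
  finally show ?thesis
    using True by simp
qed (auto simp: tail_cells_def)

definition drop_vertex :: "nat \<Rightarrow> cell \<Rightarrow> cell" where
  "drop_vertex u \<beta> = (fst \<beta>, snd \<beta> - {u})"

lemma tail_cells_X: "tail_cells \<mu> \<kappa> u \<subseteq> X_cells \<mu> \<kappa>"
  by (auto simp: tail_cells_def)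

lemma drop_vertex_X:
  assumes "\<beta> \<in> tail_cells \<mu> \<kappa> u"
  shows "drop_vertex u \<beta> \<in> X_cells \<mu> \<kappa>" "cell_dim \<beta> = Suc (cell_dim (drop_vertex u \<beta>))"
proof -
  obtain A B where \<beta>: "\<beta> = (A, B)" by force
  have fin: "finite B" and u: "u \<in> B"
    using assms by (auto simp: tail_cells_def \<beta> X_cells_finite)
  have "card (B - {u}) \<le> card B"
    using fin by (simp add: card_mono)
  then show *: "drop_vertex u \<beta> \<in> X_cells \<mu> \<kappa>"
    using assms by (auto simp: tail_cells_def \<beta> X_cells_iff drop_vertex_def)
  show "cell_dim \<beta> = Suc (cell_dim (drop_vertex u \<beta>))"
    using cell_dim_insert[of A "B - {u}" \<mu> \<kappa> u] * u by (simp add: \<beta> drop_vertex_def insert_absorb)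
qed

lemma drop_vertex_not_tail:
  assumes "\<beta> \<in> tail_cells \<mu> \<kappa> u"
  shows "drop_vertex u \<beta> \<notin> tail_cells \<mu> \<kappa> v"
proof
  assume drop: "drop_vertex u \<beta> \<in> tail_cells \<mu> \<kappa> v"
  obtain A B where \<beta>: "\<beta> = (A, B)" by force
  have v: "v \<in> B" "v \<noteq> u" and u: "u \<in> B" "B \<subseteq> {..u}"
    and X: "(A, B) \<in> X_cells \<mu> \<kappa>" and A: "{v<..\<mu>} \<subseteq> A"
    using assms drop unfolding \<beta> tail_cells_def drop_vertex_def by simp_all
  have "v < u"
    using v u by (meson atMost_iff le_neq_implies_less subsetD)
  moreover have "u \<le> \<mu>" "A \<inter> B = {}"
    using X u(1) unfolding X_cells_iff by (meson atLeastAtMost_iff subsetD, blast)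
  ultimately show False
    using A u(1) by (meson disjoint_iff greaterThanAtMost_iff subsetD)
qed

lemma tail_cells_disjoint:
  assumes "\<beta> \<in> tail_cells \<mu> \<kappa> u" "\<beta> \<in> tail_cells \<mu> \<kappa> v"
  shows "u = v"
proof -
  have "Max (snd \<beta>) = w" if "\<beta> \<in> tail_cells \<mu> \<kappa> w" for w
    using that tail_cells_iff[of "fst \<beta>" "snd \<beta>" \<mu> \<kappa> w] unfolding prod.collapse by blast
  from this[OF assms(1)] this[OF assms(2)] show ?thesis
    by (rule trans[OF sym])
qed

lemma tail_cells_range:
  assumes "\<beta> \<in> tail_cells \<mu> \<kappa> u"
  shows "0 < u" "u \<le> \<mu>"
proof -
  obtain A B where "\<beta> = (A, B)" by force
  then have "u \<in> B" "B \<subseteq> {1..\<mu>}"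
    using assms by (simp_all add: tail_cells_def X_cells_iff)
  then have "u \<in> {1..\<mu>}"
    by blast
  then show "0 < u" "u \<le> \<mu>"
    by simp_all
qed

lemma drop_vertex_neq:
  assumes \<beta>: "\<beta> \<in> tail_cells \<mu> \<kappa> u" and \<gamma>: "\<gamma> \<in> tail_cells \<mu> \<kappa> v" and "u < v"
  shows "drop_vertex u \<beta> \<noteq> drop_vertex v \<gamma>"
proof
  assume "drop_vertex u \<beta> = drop_vertex v \<gamma>"
  then have eq: "fst \<beta> = fst \<gamma>"
    by (simp add: drop_vertex_def)
  have "{u<..\<mu>} \<subseteq> fst \<beta>"
    using \<beta> by (simp add: tail_cells_def case_prod_beta)
  moreover have "v \<in> {u<..\<mu>}"
    using \<open>u < v\<close> tail_cells_range(2)[OF \<gamma>] by simp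
  ultimately have "v \<in> fst \<gamma>"
    unfolding eq by (rule subsetD)
  moreover have "v \<in> snd \<gamma>" "fst \<gamma> \<inter> snd \<gamma> = {}"
    using \<gamma> by (cases \<gamma>; simp add: tail_cells_def X_cells_iff)+
  ultimately show False
    by blast
qed

definition tail_edges :: "nat \<Rightarrow> nat \<Rightarrow> nat \<Rightarrow> (cell \<times> cell) set" where
  "tail_edges \<mu> \<kappa> u = (\<lambda>\<beta>. (drop_vertex u \<beta>, \<beta>)) ` tail_cells \<mu> \<kappa> u"

definition second_edges :: "(cell \<times> cell) set \<Rightarrow> (cell \<times> cell) set" where
  "second_edges W = {(\<alpha>, \<beta>) \<in> W. fst \<alpha> = fst \<beta>}"

definition cells_of_dim :: "nat \<Rightarrow> nat \<Rightarrow> nat \<Rightarrow> cell set" where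
  "cells_of_dim \<mu> \<kappa> p = {\<alpha> \<in> X_cells \<mu> \<kappa>. cell_dim \<alpha> = p}"

text \<open>The state \<open>s\<close>, reached from \<open>s0\<close> in dimension \<open>p\<close> with \<open>r = 2\<close> after the passes for all
  vertices larger than \<open>n\<close>.\<close>

definition coord2_inv :: "nat \<Rightarrow> nat \<Rightarrow> nat \<Rightarrow> state \<Rightarrow> nat \<Rightarrow> state \<Rightarrow> bool" where
  "coord2_inv \<mu> \<kappa> p s0 n s \<longleftrightarrow>
     snd s p = cells_of_dim \<mu> \<kappa> p - (\<Union>v\<in>{n<..}. drop_vertex v ` tail_cells \<mu> \<kappa> v) \<and>
     snd s (p + 1) \<subseteq> cells_of_dim \<mu> \<kappa> (p + 1) \<and>
     (\<forall>v. \<forall>\<beta> \<in> tail_cells \<mu> \<kappa> v. cell_dim \<beta> = p + 1 \<longrightarrow> (\<beta> \<in> snd s (p + 1) \<longleftrightarrow> v \<le> n)) \<and>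
     second_edges (fst s) = second_edges (fst s0) \<union>
       {(\<alpha>, \<beta>). (\<exists>v>n. (\<alpha>, \<beta>) \<in> tail_edges \<mu> \<kappa> v) \<and> cell_dim \<beta> = p + 1} \<and>
     (\<forall>q<p. snd s q = snd s0 q)"

lemma coord2_invD:
  assumes "coord2_inv \<mu> \<kappa> p s0 n s"
  shows "snd s p = cells_of_dim \<mu> \<kappa> p - (\<Union>v\<in>{n<..}. drop_vertex v ` tail_cells \<mu> \<kappa> v)"
    and "snd s (p + 1) \<subseteq> cells_of_dim \<mu> \<kappa> (p + 1)"
    and "\<And>v \<beta>. \<beta> \<in> tail_cells \<mu> \<kappa> v \<Longrightarrow> cell_dim \<beta> = p + 1 \<Longrightarrow> \<beta> \<in> snd s (p + 1) \<longleftrightarrow> v \<le> n"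
    and "second_edges (fst s) = second_edges (fst s0) \<union>
       {(\<alpha>, \<beta>). (\<exists>v>n. (\<alpha>, \<beta>) \<in> tail_edges \<mu> \<kappa> v) \<and> cell_dim \<beta> = p + 1}"
    and "\<And>q. q < p \<Longrightarrow> snd s q = snd s0 q"
  using assms unfolding coord2_inv_def by simp_all

lemma matched_second:
  assumes inv: "coord2_inv \<mu> \<kappa> p s0 u (W, F)"
  shows "matched (X_cells \<mu> \<kappa>) p 2 u F =
    drop_vertex u ` {\<beta> \<in> tail_cells \<mu> \<kappa> u. cell_dim \<beta> = p + 1}"
proof (intro equalityI subsetI)
  note inv = coord2_invD[OF inv, unfolded fst_conv snd_conv]
  fix \<alpha> assume "\<alpha> \<in> drop_vertex u ` {\<beta> \<in> tail_cells \<mu> \<kappa> u. cell_dim \<beta> = p + 1}"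
  then obtain \<beta> where \<beta>: "\<beta> \<in> tail_cells \<mu> \<kappa> u" "cell_dim \<beta> = p + 1" "\<alpha> = drop_vertex u \<beta>"
    by auto
  have add: "add_vertex 2 \<alpha> u = \<beta>"
    using \<beta> by (auto simp: add_vertex_def drop_vertex_def tail_cells_def)
  have "\<alpha> \<notin> drop_vertex v ` tail_cells \<mu> \<kappa> v" if "u < v" for v
    using drop_vertex_neq[OF \<beta>(1) _ that] unfolding \<beta>(3) by blast
  moreover have "\<alpha> \<in> cells_of_dim \<mu> \<kappa> p"
    using drop_vertex_X[OF \<beta>(1)] \<beta> by (simp add: cells_of_dim_def)
  ultimately have "\<alpha> \<in> F p"
    unfolding inv(1) by blast
  moreover have "add_vertex_defined (X_cells \<mu> \<kappa>) 2 \<alpha> u"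
    using \<beta> add by (auto simp: add_vertex_defined_def drop_vertex_def tail_cells_def X_cells_iff)
  moreover have "\<beta> \<in> F (p + 1)"
    using inv(3)[OF \<beta>(1,2)] by simp
  ultimately show "\<alpha> \<in> matched (X_cells \<mu> \<kappa>) p 2 u F"
    using add by (auto simp: matched_def)
next
  note inv = coord2_invD[OF inv, unfolded fst_conv snd_conv]
  fix \<alpha> assume m: "\<alpha> \<in> matched (X_cells \<mu> \<kappa>) p 2 u F"
  obtain A B where \<alpha>: "\<alpha> = (A, B)" by force
  have u: "u \<notin> A" "u \<notin> B" and X: "(A, insert u B) \<in> X_cells \<mu> \<kappa>"
    and Fp: "(A, B) \<in> F p" and Fq: "(A, insert u B) \<in> F (p + 1)"
    using m by (auto simp: matched_def \<alpha> add_vertex_defined_def add_vertex_def)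
  have AB: "(A, B) \<in> X_cells \<mu> \<kappa>" and dim: "cell_dim (A, B) = p"
    using Fp unfolding inv(1) by (simp_all add: cells_of_dim_def)
  have dim': "cell_dim (A, insert u B) = p + 1"
    using cell_dim_insert[OF AB u(2)] dim by simp
  define v where "v = Max ({1..\<mu>} - A)"
  have u\<mu>: "u \<in> {1..\<mu>} - A"
    using X u by (auto simp: X_cells_iff)
  then have v: "v \<in> {1..\<mu>} - A"
    unfolding v_def by (intro Max_in) auto
  have v_max: "w \<le> v" if "w \<in> {1..\<mu>} - A" for w
    using that unfolding v_def by (intro Max_ge) auto
  have AB': "B \<subseteq> {1..\<mu>}" "A \<inter> B = {}" "B \<noteq> {}"
    using AB by (simp_all add: X_cells_iff)
  then have B: "B \<subseteq> {..v}" "B \<noteq> {}"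
    using v_max by blast+
  have A: "{v<..\<mu>} \<subseteq> A"
  proof
    fix w assume "w \<in> {v<..\<mu>}"
    then show "w \<in> A"
      using v_max[of w] by (cases "w \<in> A") simp_all
  qed
  have "u = v"
  proof (rule ccontr)
    assume "u \<noteq> v"
    with v_max[OF u\<mu>] have uv: "u < v" by simp
    show False
    proof (cases "v \<in> B")
      case True
      then have "(A, insert u B) \<in> tail_cells \<mu> \<kappa> v"
        using X A B uv u by (auto simp: tail_cells_def)
      then show False
        using inv(3)[OF _ dim'] Fq uv by auto
    next
      case False
      have "card (insert v B) = card (insert u B)"
        using False u X_cells_finite[OF AB] by simp
      then have "(A, insert v B) \<in> X_cells \<mu> \<kappa>"
        using X v u by (auto simp: X_cells_iff)
      then have "(A, insert v B) \<in> tail_cells \<mu> \<kappa> v"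
        using A B False by (auto simp: tail_cells_def)
      moreover have "(A, B) = drop_vertex v (A, insert v B)"
        using False by (auto simp: drop_vertex_def)
      ultimately have "(A, B) \<notin> F p"
        using uv unfolding inv(1) by blast
      then show False using Fp by simp
    qed
  qed
  then have "(A, insert u B) \<in> tail_cells \<mu> \<kappa> u"
    using X A B u by (auto simp: tail_cells_def)
  moreover have "\<alpha> = drop_vertex u (A, insert u B)"
    using u by (auto simp: drop_vertex_def \<alpha>)
  ultimately show "\<alpha> \<in> drop_vertex u ` {\<beta> \<in> tail_cells \<mu> \<kappa> u. cell_dim \<beta> = p + 1}"
    using dim' by blast
qed

lemma second_edges_Un: "second_edges (V \<union> W) = second_edges V \<union> second_edges W"
  by (auto simp: second_edges_def)

lemma coord2_inv_step:
  assumes inv: "coord2_inv \<mu> \<kappa> p s0 (Suc n) s"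
  shows "coord2_inv \<mu> \<kappa> p s0 n (vertex_step (X_cells \<mu> \<kappa>) p 2 (Suc n) s)"
proof -
  obtain W F where s: "s = (W, F)" by force
  define T where "T = {\<beta> \<in> tail_cells \<mu> \<kappa> (Suc n). cell_dim \<beta> = p + 1}"
  have M: "matched (X_cells \<mu> \<kappa>) p 2 (Suc n) F = drop_vertex (Suc n) ` T"
    using matched_second inv unfolding s T_def by blast
  have add: "add_vertex 2 (drop_vertex (Suc n) \<beta>) (Suc n) = \<beta>" if "\<beta> \<in> T" for \<beta>
    using that by (auto simp: add_vertex_def drop_vertex_def tail_cells_def T_def)
  note inv = coord2_invD[OF inv, unfolded s fst_conv snd_conv]
  have Fp: "F p \<subseteq> X_cells \<mu> \<kappa>"
    unfolding inv(1) by (auto simp: cells_of_dim_def)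
  have im1: "(\<lambda>\<alpha>. (\<alpha>, add_vertex 2 \<alpha> (Suc n))) ` drop_vertex (Suc n) ` T =
      (\<lambda>\<beta>. (drop_vertex (Suc n) \<beta>, \<beta>)) ` T"
    using add by (force simp: image_image)
  have im2: "(\<lambda>\<alpha>. add_vertex 2 \<alpha> (Suc n)) ` drop_vertex (Suc n) ` T = T"
    using add by (force simp: image_image)
  have step: "vertex_step (X_cells \<mu> \<kappa>) p 2 (Suc n) s =
      (W \<union> (\<lambda>\<beta>. (drop_vertex (Suc n) \<beta>, \<beta>)) ` T,
       F(p := F p - drop_vertex (Suc n) ` T, p + 1 := F (p + 1) - T))"
    unfolding s vertex_step_eq[where F = F and p = p, OF Fp] M im1 im2 ..
  have split: "{n<..} = insert (Suc n) {Suc n<..}"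
    by auto
  have "cells_of_dim \<mu> \<kappa> p - drop_vertex (Suc n) ` T =
      cells_of_dim \<mu> \<kappa> p - drop_vertex (Suc n) ` tail_cells \<mu> \<kappa> (Suc n)"
    using drop_vertex_X(2) unfolding T_def cells_of_dim_def by fastforce
  then have 1: "F p - drop_vertex (Suc n) ` T =
      cells_of_dim \<mu> \<kappa> p - (\<Union>v\<in>{n<..}. drop_vertex v ` tail_cells \<mu> \<kappa> v)"
    unfolding inv(1) split by blast
  have 2: "\<beta> \<in> F (p + 1) - T \<longleftrightarrow> v \<le> n" if "\<beta> \<in> tail_cells \<mu> \<kappa> v" "cell_dim \<beta> = p + 1" for v \<beta>
  proof -
    have "\<beta> \<in> F (p + 1) \<longleftrightarrow> v \<le> Suc n"
      using inv(3) that by blast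
    moreover have "\<beta> \<in> T \<longleftrightarrow> v = Suc n"
      using that tail_cells_disjoint unfolding T_def by blast
    ultimately show ?thesis by auto
  qed
  have new: "second_edges ((\<lambda>\<beta>. (drop_vertex (Suc n) \<beta>, \<beta>)) ` T) =
     {(\<alpha>, \<beta>). (\<alpha>, \<beta>) \<in> tail_edges \<mu> \<kappa> (Suc n) \<and> cell_dim \<beta> = p + 1}"
    by (auto simp: second_edges_def tail_edges_def T_def drop_vertex_def)
  have 3: "second_edges (W \<union> (\<lambda>\<beta>. (drop_vertex (Suc n) \<beta>, \<beta>)) ` T) = second_edges (fst s0) \<union>
       {(\<alpha>, \<beta>). (\<exists>v>n. (\<alpha>, \<beta>) \<in> tail_edges \<mu> \<kappa> v) \<and> cell_dim \<beta> = p + 1}"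
  proof -
    have split_ex: "(\<exists>v>n. e \<in> tail_edges \<mu> \<kappa> v) \<longleftrightarrow>
        e \<in> tail_edges \<mu> \<kappa> (Suc n) \<or> (\<exists>v>Suc n. e \<in> tail_edges \<mu> \<kappa> v)" for e
      by (metis Suc_lessD Suc_lessI lessI)
    show ?thesis
      unfolding second_edges_Un new inv(4) split_ex by blast
  qed
  show ?thesis
    unfolding coord2_inv_def step fst_conv snd_conv
  proof (intro conjI allI ballI impI)
    fix q assume "q < p"
    then show "(F(p := F p - drop_vertex (Suc n) ` T, p + 1 := F (p + 1) - T)) q = snd s0 q"
      using inv(5) by simp
  next
    show "(F(p := F p - drop_vertex (Suc n) ` T, p + 1 := F (p + 1) - T)) (p + 1)
        \<subseteq> cells_of_dim \<mu> \<kappa> (p + 1)"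
      using inv(2) unfolding fun_upd_same by blast
  next
    show "(F(p := F p - drop_vertex (Suc n) ` T, p + 1 := F (p + 1) - T)) p =
        cells_of_dim \<mu> \<kappa> p - (\<Union>v\<in>{n<..}. drop_vertex v ` tail_cells \<mu> \<kappa> v)"
      unfolding 1[symmetric] by simp
  next
    show "\<beta> \<in> (F(p := F p - drop_vertex (Suc n) ` T, p + 1 := F (p + 1) - T)) (p + 1) \<longleftrightarrow> v \<le> n"
      if "\<beta> \<in> tail_cells \<mu> \<kappa> v" "cell_dim \<beta> = p + 1" for v \<beta>
      unfolding fun_upd_same by (rule 2[OF that])
  qed (rule 3)
qed

lemma coord2_inv_fold:
  assumes "coord2_inv \<mu> \<kappa> p s0 n s"
  shows "coord2_inv \<mu> \<kappa> p s0 0 (fold (vertex_step (X_cells \<mu> \<kappa>) p 2) (rev [1..<n + 1]) s)"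
  using assms
proof (induction n arbitrary: s)
  case (Suc n)
  then show ?case
    using coord2_inv_step by simp
qed simp

text \<open>The state \<open>s\<close>, reached from \<open>s0\<close> in dimension \<open>p\<close> during the passes with \<open>r = 1\<close>.\<close>

definition coord1_inv :: "nat \<Rightarrow> nat \<Rightarrow> nat \<Rightarrow> state \<Rightarrow> state \<Rightarrow> bool" where
  "coord1_inv \<mu> \<kappa> p s0 s \<longleftrightarrow>
     snd s p \<subseteq> cells_of_dim \<mu> \<kappa> p \<and>
     (\<forall>v. \<forall>\<beta> \<in> tail_cells \<mu> \<kappa> v. cell_dim \<beta> = p \<longrightarrow> \<beta> \<in> snd s p) \<and>
     snd s (p + 1) \<subseteq> cells_of_dim \<mu> \<kappa> (p + 1) \<and>
     (\<forall>v. \<forall>\<beta> \<in> tail_cells \<mu> \<kappa> v. \<beta> \<notin> snd s (p + 1)) \<and>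
     second_edges (fst s) = second_edges (fst s0) \<and>
     (\<forall>q<p. snd s q = snd s0 q)"

lemma coord1_invD:
  assumes "coord1_inv \<mu> \<kappa> p s0 s"
  shows "snd s p \<subseteq> cells_of_dim \<mu> \<kappa> p"
    and "\<And>v \<beta>. \<beta> \<in> tail_cells \<mu> \<kappa> v \<Longrightarrow> cell_dim \<beta> = p \<Longrightarrow> \<beta> \<in> snd s p"
    and "snd s (p + 1) \<subseteq> cells_of_dim \<mu> \<kappa> (p + 1)"
    and "\<And>v \<beta>. \<beta> \<in> tail_cells \<mu> \<kappa> v \<Longrightarrow> \<beta> \<notin> snd s (p + 1)"
    and "second_edges (fst s) = second_edges (fst s0)"
    and "\<And>q. q < p \<Longrightarrow> snd s q = snd s0 q"
  using assms unfolding coord1_inv_def by simp_all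

lemma coord1_inv_step:
  assumes inv: "coord1_inv \<mu> \<kappa> p s0 s"
  shows "coord1_inv \<mu> \<kappa> p s0 (vertex_step (X_cells \<mu> \<kappa>) p 1 u s)"
proof -
  obtain W F where s: "s = (W, F)" by force
  note inv = coord1_invD[OF inv, unfolded s fst_conv snd_conv]
  define M where "M = matched (X_cells \<mu> \<kappa>) p 1 u F"
  have Fp: "F p \<subseteq> X_cells \<mu> \<kappa>"
    using inv(1) unfolding cells_of_dim_def by blast
  have step: "vertex_step (X_cells \<mu> \<kappa>) p 1 u s =
      (W \<union> (\<lambda>\<alpha>. (\<alpha>, add_vertex 1 \<alpha> u)) ` M,
       F(p := F p - M, p + 1 := F (p + 1) - (\<lambda>\<alpha>. add_vertex 1 \<alpha> u) ` M))"
    unfolding s vertex_step_eq[where F = F and p = p, OF Fp] M_def ..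
  have not_tail: "\<alpha> \<notin> M" if "\<alpha> \<in> tail_cells \<mu> \<kappa> v" for \<alpha> v
  proof
    assume "\<alpha> \<in> M"
    then have "add_vertex_defined (X_cells \<mu> \<kappa>) 1 \<alpha> u" "add_vertex 1 \<alpha> u \<in> F (p + 1)"
      by (auto simp: M_def matched_def)
    moreover from this that have "add_vertex 1 \<alpha> u \<in> tail_cells \<mu> \<kappa> v"
      by (auto simp: add_vertex_defined_def add_vertex_def tail_cells_def)
    ultimately show False
      using inv(4) by blast
  qed
  have none: "second_edges ((\<lambda>\<alpha>. (\<alpha>, add_vertex 1 \<alpha> u)) ` M) = {}"
    by (auto simp: second_edges_def M_def matched_def add_vertex_defined_def add_vertex_def)
  show ?thesis
    unfolding coord1_inv_def step fst_conv snd_conv second_edges_Un none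
  proof (intro conjI allI ballI impI)
    fix q assume "q < p"
    then show "(F(p := F p - M, p + 1 := F (p + 1) - (\<lambda>\<alpha>. add_vertex 1 \<alpha> u) ` M)) q = snd s0 q"
      using inv(6) by simp
  next
    show "(F(p := F p - M, p + 1 := F (p + 1) - (\<lambda>\<alpha>. add_vertex 1 \<alpha> u) ` M)) (p + 1)
        \<subseteq> cells_of_dim \<mu> \<kappa> (p + 1)"
      using inv(3) unfolding fun_upd_same by blast
  next
    show "\<beta> \<in> (F(p := F p - M, p + 1 := F (p + 1) - (\<lambda>\<alpha>. add_vertex 1 \<alpha> u) ` M)) p"
      if "\<beta> \<in> tail_cells \<mu> \<kappa> v" "cell_dim \<beta> = p" for v \<beta>
      using inv(2)[OF that] not_tail[OF that(1)] by simp
  next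
    show "\<beta> \<notin> (F(p := F p - M, p + 1 := F (p + 1) - (\<lambda>\<alpha>. add_vertex 1 \<alpha> u) ` M)) (p + 1)"
      if "\<beta> \<in> tail_cells \<mu> \<kappa> v" for v \<beta>
      using inv(4)[OF that] unfolding fun_upd_same by blast
  next
    show "(F(p := F p - M, p + 1 := F (p + 1) - (\<lambda>\<alpha>. add_vertex 1 \<alpha> u) ` M)) p
        \<subseteq> cells_of_dim \<mu> \<kappa> p"
      using inv(1) by auto
  qed (use inv(5) in simp)
qed

lemma coord1_inv_fold:
  assumes "coord1_inv \<mu> \<kappa> p s0 s"
  shows "coord1_inv \<mu> \<kappa> p s0 (fold (vertex_step (X_cells \<mu> \<kappa>) p 1) us s)"
  using assms by (induction us arbitrary: s) (simp_all add: coord1_inv_step del: One_nat_def)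

text \<open>The state \<open>s\<close> after all dimensions at least \<open>p\<close> have been processed.\<close>

definition dim_inv :: "nat \<Rightarrow> nat \<Rightarrow> nat \<Rightarrow> state \<Rightarrow> bool" where
  "dim_inv \<mu> \<kappa> p s \<longleftrightarrow>
     (\<forall>q<p. snd s q = cells_of_dim \<mu> \<kappa> q) \<and>
     snd s p \<subseteq> cells_of_dim \<mu> \<kappa> p \<and>
     (\<forall>v. \<forall>\<beta> \<in> tail_cells \<mu> \<kappa> v. cell_dim \<beta> = p \<longrightarrow> \<beta> \<in> snd s p) \<and>
     second_edges (fst s) =
       {(\<alpha>, \<beta>). (\<exists>v. (\<alpha>, \<beta>) \<in> tail_edges \<mu> \<kappa> v) \<and> p < cell_dim \<beta>}"

lemma dim_invD:
  assumes "dim_inv \<mu> \<kappa> p s"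
  shows "\<And>q. q < p \<Longrightarrow> snd s q = cells_of_dim \<mu> \<kappa> q"
    and "snd s p \<subseteq> cells_of_dim \<mu> \<kappa> p"
    and "\<And>v \<beta>. \<beta> \<in> tail_cells \<mu> \<kappa> v \<Longrightarrow> cell_dim \<beta> = p \<Longrightarrow> \<beta> \<in> snd s p"
    and "second_edges (fst s) =
       {(\<alpha>, \<beta>). (\<exists>v. (\<alpha>, \<beta>) \<in> tail_edges \<mu> \<kappa> v) \<and> p < cell_dim \<beta>}"
  using assms unfolding dim_inv_def by simp_all

lemma tail_edges_range:
  assumes "e \<in> tail_edges \<mu> \<kappa> v"
  shows "0 < v" "v \<le> \<mu>"
  using assms tail_cells_range unfolding tail_edges_def by blast+

lemma dim_inv_step:
  assumes inv: "dim_inv \<mu> \<kappa> (Suc p) s"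
  shows "dim_inv \<mu> \<kappa> p (dimension_step \<mu> (X_cells \<mu> \<kappa>) p s)"
proof (cases "snd s p \<noteq> {} \<and> snd s (p + 1) \<noteq> {}")
  case True
  note inv = dim_invD[OF inv]
  define s1 where "s1 = coordinate_step \<mu> (X_cells \<mu> \<kappa>) p 2 s"
  define s2 where "s2 = coordinate_step \<mu> (X_cells \<mu> \<kappa>) p 1 s1"
  have s2: "dimension_step \<mu> (X_cells \<mu> \<kappa>) p s = s2"
    using True by (simp add: dimension_step_def s1_def s2_def)
  have "coord2_inv \<mu> \<kappa> p s \<mu> s"
    unfolding coord2_inv_def
  proof (intro conjI allI ballI impI)
    have "tail_cells \<mu> \<kappa> v = {}" if "v \<in> {\<mu><..}" for v
      using that tail_cells_range(2) leD unfolding greaterThan_iff by blast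
    then show "snd s p = cells_of_dim \<mu> \<kappa> p - (\<Union>v\<in>{\<mu><..}. drop_vertex v ` tail_cells \<mu> \<kappa> v)"
      using inv(1)[of p] by simp
    show "snd s (p + 1) \<subseteq> cells_of_dim \<mu> \<kappa> (p + 1)"
      using inv(2) by simp
    show "\<beta> \<in> snd s (p + 1) \<longleftrightarrow> v \<le> \<mu>" if "\<beta> \<in> tail_cells \<mu> \<kappa> v" "cell_dim \<beta> = p + 1" for \<beta> v
      using inv(3)[OF that(1)] that(2) tail_cells_range(2)[OF that(1)] by simp
    have "(\<alpha>, \<beta>) \<notin> tail_edges \<mu> \<kappa> v" if "v > \<mu>" for \<alpha> \<beta> v
      using that tail_edges_range(2) leD by blast
    then show "second_edges (fst s) = second_edges (fst s) \<union>
        {(\<alpha>, \<beta>). (\<exists>v>\<mu>. (\<alpha>, \<beta>) \<in> tail_edges \<mu> \<kappa> v) \<and> cell_dim \<beta> = p + 1}"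
      by blast
  qed simp
  then have "coord2_inv \<mu> \<kappa> p s 0 s1"
    unfolding s1_def coordinate_step_def by (rule coord2_inv_fold)
  note s1 = coord2_invD[OF this]
  have "coord1_inv \<mu> \<kappa> p s1 s1"
    unfolding coord1_inv_def
  proof (intro conjI allI ballI impI)
    show "snd s1 p \<subseteq> cells_of_dim \<mu> \<kappa> p"
      unfolding s1(1) by blast
    show "\<beta> \<in> snd s1 p" if "\<beta> \<in> tail_cells \<mu> \<kappa> v" "cell_dim \<beta> = p" for \<beta> v
    proof -
      have "\<beta> \<in> cells_of_dim \<mu> \<kappa> p"
        using that tail_cells_X unfolding cells_of_dim_def by blast
      moreover have "\<beta> \<notin> drop_vertex w ` tail_cells \<mu> \<kappa> w" for w
        using that(1) drop_vertex_not_tail by blast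
      ultimately show ?thesis
        unfolding s1(1) by blast
    qed
    show "snd s1 (p + 1) \<subseteq> cells_of_dim \<mu> \<kappa> (p + 1)"
      by (rule s1(2))
    show "\<beta> \<notin> snd s1 (p + 1)" if \<beta>: "\<beta> \<in> tail_cells \<mu> \<kappa> v" for \<beta> v
    proof
      assume "\<beta> \<in> snd s1 (p + 1)"
      moreover from this have "cell_dim \<beta> = p + 1"
        using s1(2) unfolding cells_of_dim_def by blast
      ultimately show False
        using s1(3)[OF \<beta>] tail_cells_range(1)[OF \<beta>] by simp
    qed
  qed simp_all
  then have "coord1_inv \<mu> \<kappa> p s1 s2"
    unfolding s2_def coordinate_step_def by (rule coord1_inv_fold)
  note s2_inv = coord1_invD[OF this]
  show ?thesis
    unfolding dim_inv_def s2
  proof (intro conjI allI ballI impI)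
    show "snd s2 q = cells_of_dim \<mu> \<kappa> q" if "q < p" for q
      using inv(1)[of q] s1(5)[OF that] s2_inv(6)[OF that] that by simp
    have "Suc p < d \<or> d = p + 1 \<longleftrightarrow> p < d" for d
      by auto
    moreover have "second_edges (fst s2) =
        {(\<alpha>, \<beta>). (\<exists>v. (\<alpha>, \<beta>) \<in> tail_edges \<mu> \<kappa> v) \<and> (Suc p < cell_dim \<beta> \<or> cell_dim \<beta> = p + 1)}"
      unfolding s2_inv(5) s1(4) inv(4) using tail_edges_range(1) by blast
    ultimately show "second_edges (fst s2) =
        {(\<alpha>, \<beta>). (\<exists>v. (\<alpha>, \<beta>) \<in> tail_edges \<mu> \<kappa> v) \<and> p < cell_dim \<beta>}"
      by simp
  qed (use s2_inv(1,2) in blast)+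
next
  case False
  note inv = dim_invD[OF inv]
  have no: "cell_dim \<beta> \<noteq> Suc p" if \<beta>: "\<beta> \<in> tail_cells \<mu> \<kappa> v" for \<beta> v
  proof
    assume dim: "cell_dim \<beta> = Suc p"
    have "\<beta> \<in> snd s (p + 1)"
      using inv(3)[OF \<beta> dim] by simp
    moreover have "drop_vertex v \<beta> \<in> snd s p"
      using inv(1)[of p] drop_vertex_X[OF \<beta>] dim by (simp add: cells_of_dim_def)
    ultimately show False
      using False by blast
  qed
  have step: "dimension_step \<mu> (X_cells \<mu> \<kappa>) p s = s"
    using False unfolding dimension_step_def by (rule if_not_P)
  show ?thesis
    unfolding dim_inv_def step
  proof (intro conjI allI ballI impI)
    show "snd s q = cells_of_dim \<mu> \<kappa> q" if "q < p" for q
      using inv(1)[of q] that by simp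
    show "snd s p \<subseteq> cells_of_dim \<mu> \<kappa> p"
      using inv(1)[of p] by simp
    show "\<beta> \<in> snd s p" if "\<beta> \<in> tail_cells \<mu> \<kappa> v" "cell_dim \<beta> = p" for \<beta> v
      using that tail_cells_X unfolding inv(1)[OF lessI] cells_of_dim_def by blast
    have "Suc p < cell_dim \<beta> \<longleftrightarrow> p < cell_dim \<beta>" if "(\<alpha>, \<beta>) \<in> tail_edges \<mu> \<kappa> v" for \<alpha> \<beta> v
      using that no[of \<beta> v] by (auto simp: tail_edges_def)
    then show "second_edges (fst s) =
        {(\<alpha>, \<beta>). (\<exists>v. (\<alpha>, \<beta>) \<in> tail_edges \<mu> \<kappa> v) \<and> p < cell_dim \<beta>}"
      unfolding inv(4) by blast
  qed
qed

lemma dim_inv_fold: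
  assumes "dim_inv \<mu> \<kappa> n s"
  shows "dim_inv \<mu> \<kappa> 0 (fold (dimension_step \<mu> (X_cells \<mu> \<kappa>)) (rev [0..<n]) s)"
  using assms
proof (induction n arbitrary: s)
  case (Suc n)
  then show ?case
    using dim_inv_step by simp
qed simp

lemma second_edges_gradient_field:
  "second_edges (gradient_field \<mu> \<kappa>) = (\<Union>v. tail_edges \<mu> \<kappa> v)"
proof -
  let ?X = "X_cells \<mu> \<kappa>" and ?s = "({}, \<lambda>p. {\<alpha> \<in> X_cells \<mu> \<kappa>. cell_dim \<alpha> = p}) :: state"
  have "\<not> complex_dim ?X < cell_dim \<beta>" if "\<beta> \<in> ?X" for \<beta>
    using that finite_X_cells by (simp add: complex_dim_def not_less)
  then have "\<not> complex_dim ?X < cell_dim \<beta>" if "(\<alpha>, \<beta>) \<in> tail_edges \<mu> \<kappa> v" for \<alpha> \<beta> v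
    using that tail_cells_X unfolding tail_edges_def by blast
  then have "{(\<alpha>, \<beta>). (\<exists>v. (\<alpha>, \<beta>) \<in> tail_edges \<mu> \<kappa> v) \<and> complex_dim ?X < cell_dim \<beta>} = {}"
    by blast
  then have "dim_inv \<mu> \<kappa> (complex_dim ?X) ?s"
    unfolding dim_inv_def using tail_cells_X
    by (simp add: cells_of_dim_def second_edges_def) blast
  from dim_invD(4)[OF dim_inv_fold[OF this]]
  have D: "second_edges (gradient_field \<mu> \<kappa>) =
      {(\<alpha>, \<beta>). (\<exists>v. (\<alpha>, \<beta>) \<in> tail_edges \<mu> \<kappa> v) \<and> 0 < cell_dim \<beta>}"
    by (simp only: gradient_field_def Let_def)
  have pos: "0 < cell_dim \<beta>" if "(\<alpha>, \<beta>) \<in> tail_edges \<mu> \<kappa> v" for \<alpha> \<beta> v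
    using that drop_vertex_X(2)[of \<beta> \<mu> \<kappa> v] by (auto simp: tail_edges_def)
  show ?thesis
  proof (rule set_eqI)
    fix e :: "cell \<times> cell"
    obtain \<alpha> \<beta> where e: "e = (\<alpha>, \<beta>)" by (rule prod.exhaust)
    show "e \<in> second_edges (gradient_field \<mu> \<kappa>) \<longleftrightarrow> e \<in> (\<Union>v. tail_edges \<mu> \<kappa> v)"
      unfolding D e UN_iff mem_Collect_eq prod.case using pos by blast
  qed
qed

theorem theorem4p2:
  fixes \<mu> \<kappa> :: nat
  assumes "2 \<le> \<kappa>" and "\<kappa> \<le> \<mu> - 2"
  shows "(\<forall>A B. (A, B) \<in> X_cells \<mu> \<kappa> \<and> card B > 1 \<and> {Max B + 1..\<mu>} \<subseteq> A \<longrightarrow>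
            collapsible (gradient_field \<mu> \<kappa>) (A, B) \<and>
            ((A, B - {Max B}), (A, B)) \<in> gradient_field \<mu> \<kappa>) \<and>
         {((A', B'), (A', B' \<union> {u})) | A' B' u.
            ((A', B'), (A', B' \<union> {u})) \<in> gradient_field \<mu> \<kappa>} =
         {((A, B - {Max B}), (A, B)) | A B.
            (A, B) \<in> X_cells \<mu> \<kappa> \<and> card B > 1 \<and> {Max B + 1..\<mu>} \<subseteq> A}"
    (is "?P \<and> ?L = ?R")
proof -
  let ?W = "gradient_field \<mu> \<kappa>"
  have R: "(\<Union>v. tail_edges \<mu> \<kappa> v) = ?R"
  proof (intro equalityI subsetI)
    fix e assume "e \<in> (\<Union>v. tail_edges \<mu> \<kappa> v)"
    then obtain v A B where "e = ((A, B - {v}), (A, B))" "(A, B) \<in> tail_cells \<mu> \<kappa> v"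
      by (auto simp: tail_edges_def drop_vertex_def)
    then show "e \<in> ?R"
      unfolding tail_cells_iff by blast
  next
    fix e assume "e \<in> ?R"
    then obtain A B where e: "e = ((A, B - {Max B}), (A, B))" "(A, B) \<in> tail_cells \<mu> \<kappa> (Max B)"
      unfolding tail_cells_iff by blast
    then have "e = (drop_vertex (Max B) (A, B), (A, B))"
      by (simp add: drop_vertex_def)
    with e(2) show "e \<in> (\<Union>v. tail_edges \<mu> \<kappa> v)"
      unfolding tail_edges_def by blast
  qed
  have W: "second_edges ?W = ?R"
    using second_edges_gradient_field R by simp
  have "?R \<subseteq> ?W"
    unfolding W[symmetric] by (auto simp: second_edges_def)
  then have 1: ?P
    unfolding collapsible_def by blast
  have "?L \<subseteq> second_edges ?W"
    by (auto simp: second_edges_def)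
  then have "?L \<subseteq> ?R"
    unfolding W .
  moreover have "?R \<subseteq> ?L"
  proof
    fix e assume e: "e \<in> ?R"
    then obtain A B where AB: "e = ((A, B - {Max B}), (A, B))" "(A, B) \<in> X_cells \<mu> \<kappa>"
      by blast
    have "Max B \<in> B"
      using X_cells_finite[OF AB(2)] AB(2) by (simp add: X_cells_iff)
    then have B: "(B - {Max B}) \<union> {Max B} = B"
      by blast
    have "((A, B - {Max B}), (A, (B - {Max B}) \<union> {Max B})) \<in> ?W"
      unfolding B using AB(1) e \<open>?R \<subseteq> ?W\<close> by blast
    moreover have "e = ((A, B - {Max B}), (A, (B - {Max B}) \<union> {Max B}))"
      unfolding B by (rule AB(1))
    ultimately show "e \<in> ?L"
      by blast
  qed
  ultimately show ?thesis
    by (intro conjI 1 equalityI)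
qed

end
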